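(* Let $\rho : \mathfrak g \to \mathrm{End}(W)$ be a finite-dimensional representation of a complex semisimple Lie algebra $\mathfrak g$, and $\mathfrak h$ a Cartan subalgebra. Let $\lambda$ be a weight of $\mathfrak h$ in $W$ and $W_\lambda = \{w \in W : Hw = \lambda(H) w \ \forall H \in \mathfrak h\}$. If there exists a co-root $H_\alpha$ such that $\lambda(H_\alpha)$ is an even nonzero integer, then $W_\lambda \otimes \mathfrak h$ is contained in the $\mathfrak g$-submodule of $W \otimes \mathfrak g$ generated by the $\mathfrak g$-overshears.
   Context: $W \otimes \mathfrak g$ is a $\mathfrak g$-module via $(\rho\otimes \mathrm{ad})(\xi)(w\otimes \eta) = \rho(\xi)w \otimes \eta + w \otimes [\xi,\eta]$. An element $w \otimes \xi$ ($w\in W$, $\xi \in \mathfrak g$) is a $\mathfrak g$-overshear if $\rho(\xi)^2 w = 0$. For a root $\alpha$, $H_\alpha\in\mathfrak h$ is the co-root, i.e. there are $E_\alpha \in \mathfrak g_\alpha$, $F_\alpha\in\mathfrak g_{-\alpha}$ with $[H_\alpha,E_\alpha]=2E_\alpha$, $[H_\alpha,F_\alpha]=-2F_\alpha$, $[E_\alpha,F_\alpha]=H_\alpha$. *)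

theory Defs
  imports "HOL-Analysis.Analysis"
begin

text \<open>Conventions. A finite-dimensional complex Lie algebra g is modelled (after a choice
of basis) as the coordinate space complex^'m with a bracket br; a finite-dimensional
representation space W is complex^'n. The tensor product W (x) g is complex^'m^'n, with
pure tensors w (x) xi given by the outer product.\<close>

type_synonym ('m) lie_bracket = "complex^'m \<Rightarrow> complex^'m \<Rightarrow> complex^'m"

definition lie_algebra :: "('m::finite) lie_bracket \<Rightarrow> bool" where
  "lie_algebra br \<longleftrightarrow>
     (\<forall>x. Vector_Spaces.linear (*s) (*s) (br x)) \<and>
     (\<forall>y. Vector_Spaces.linear (*s) (*s) (\<lambda>x. br x y)) \<and>
     (\<forall>x. br x x = 0) \<and>
     (\<forall>x y z. br x (br y z) + br y (br z x) + br z (br x y) = 0)"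

definition lie_subalgebra :: "('m::finite) lie_bracket \<Rightarrow> (complex^'m) set \<Rightarrow> bool" where
  "lie_subalgebra br h \<longleftrightarrow> vec.subspace h \<and> (\<forall>x\<in>h. \<forall>y\<in>h. br x y \<in> h)"

definition lie_ideal :: "('m::finite) lie_bracket \<Rightarrow> (complex^'m) set \<Rightarrow> bool" where
  "lie_ideal br I \<longleftrightarrow> vec.subspace I \<and> (\<forall>x. \<forall>y\<in>I. br x y \<in> I)"

primrec derived_series :: "('m::finite) lie_bracket \<Rightarrow> (complex^'m) set \<Rightarrow> nat \<Rightarrow> (complex^'m) set" where
  "derived_series br I 0 = I"
| "derived_series br I (Suc k) =
     vec.span {br x y | x y. x \<in> derived_series br I k \<and> y \<in> derived_series br I k}"

definition solvable_lie :: "('m::finite) lie_bracket \<Rightarrow> (complex^'m) set \<Rightarrow> bool" where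
  "solvable_lie br I \<longleftrightarrow> (\<exists>k. derived_series br I k = {0})"

text \<open>Semisimple: no nonzero solvable ideals (radical is zero).\<close>
definition semisimple :: "('m::finite) lie_bracket \<Rightarrow> bool" where
  "semisimple br \<longleftrightarrow> lie_algebra br \<and>
     (\<forall>I. lie_ideal br I \<and> solvable_lie br I \<longrightarrow> I = {0})"

primrec lower_central :: "('m::finite) lie_bracket \<Rightarrow> (complex^'m) set \<Rightarrow> nat \<Rightarrow> (complex^'m) set" where
  "lower_central br h 0 = h"
| "lower_central br h (Suc k) =
     vec.span {br x y | x y. x \<in> h \<and> y \<in> lower_central br h k}"

definition nilpotent_lie :: "('m::finite) lie_bracket \<Rightarrow> (complex^'m) set \<Rightarrow> bool" where
  "nilpotent_lie br h \<longleftrightarrow> (\<exists>k. lower_central br h k = {0})"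

text \<open>Cartan subalgebra: nilpotent self-normalizing subalgebra.\<close>
definition cartan_subalgebra :: "('m::finite) lie_bracket \<Rightarrow> (complex^'m) set \<Rightarrow> bool" where
  "cartan_subalgebra br h \<longleftrightarrow> lie_subalgebra br h \<and> nilpotent_lie br h \<and>
     {x. \<forall>y\<in>h. br x y \<in> h} = h"

definition root_space :: "('m::finite) lie_bracket \<Rightarrow> (complex^'m) set \<Rightarrow> (complex^'m \<Rightarrow> complex) \<Rightarrow> (complex^'m) set" where
  "root_space br h \<alpha> = {x. \<forall>H\<in>h. br H x = \<alpha> H *s x}"

definition is_root :: "('m::finite) lie_bracket \<Rightarrow> (complex^'m) set \<Rightarrow> (complex^'m \<Rightarrow> complex) \<Rightarrow> bool" where
  "is_root br h \<alpha> \<longleftrightarrow> (\<exists>H\<in>h. \<alpha> H \<noteq> 0) \<and> root_space br h \<alpha> \<noteq> {0}"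

text \<open>Ha is the co-root of the root alpha.\<close>
definition is_coroot :: "('m::finite) lie_bracket \<Rightarrow> (complex^'m) set \<Rightarrow> (complex^'m \<Rightarrow> complex) \<Rightarrow> complex^'m \<Rightarrow> bool" where
  "is_coroot br h \<alpha> Ha \<longleftrightarrow> is_root br h \<alpha> \<and> Ha \<in> h \<and>
     (\<exists>E F. E \<in> root_space br h \<alpha> \<and> F \<in> root_space br h (\<lambda>H. - \<alpha> H) \<and>
        br Ha E = 2 *s E \<and> br Ha F = (-2) *s F \<and> br E F = Ha)"

definition representation :: "('m::finite) lie_bracket \<Rightarrow> (complex^'m \<Rightarrow> complex^'n::finite \<Rightarrow> complex^'n) \<Rightarrow> bool" where
  "representation br \<rho> \<longleftrightarrow>
     (\<forall>\<xi>. Vector_Spaces.linear (*s) (*s) (\<rho> \<xi>)) \<and>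
     (\<forall>w. Vector_Spaces.linear (*s) (*s) (\<lambda>\<xi>. \<rho> \<xi> w)) \<and>
     (\<forall>\<xi> \<eta> w. \<rho> (br \<xi> \<eta>) w = \<rho> \<xi> (\<rho> \<eta> w) - \<rho> \<eta> (\<rho> \<xi> w))"

definition weight_space :: "(complex^'m::finite \<Rightarrow> complex^'n::finite \<Rightarrow> complex^'n) \<Rightarrow> (complex^'m) set \<Rightarrow> (complex^'m \<Rightarrow> complex) \<Rightarrow> (complex^'n) set" where
  "weight_space \<rho> h lam = {w. \<forall>H\<in>h. \<rho> H w = lam H *s w}"

definition is_weight :: "(complex^'m::finite \<Rightarrow> complex^'n::finite \<Rightarrow> complex^'n) \<Rightarrow> (complex^'m) set \<Rightarrow> (complex^'m \<Rightarrow> complex) \<Rightarrow> bool" where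
  "is_weight \<rho> h lam \<longleftrightarrow> weight_space \<rho> h lam \<noteq> {0}"

text \<open>Pure tensor w (x) xi in W (x) g = complex^'m^'n.\<close>
definition tensor :: "complex^'n::finite \<Rightarrow> complex^'m::finite \<Rightarrow> complex^'m^'n" where
  "tensor w \<xi> = (\<chi> i j. w$i * \<xi>$j)"

text \<open>The action (rho (x) ad)(xi) on W (x) g, i.e. the linear extension of
  w (x) eta |-> rho(xi) w (x) eta + w (x) [xi, eta], written via the decomposition
  T = sum_j (column j of T) (x) e_j.\<close>
definition tensor_act :: "('m::finite) lie_bracket \<Rightarrow> (complex^'m \<Rightarrow> complex^'n::finite \<Rightarrow> complex^'n) \<Rightarrow> complex^'m \<Rightarrow> complex^'m^'n \<Rightarrow> complex^'m^'n" where
  "tensor_act br \<rho> \<xi> T =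
     (\<Sum>j\<in>UNIV. tensor (\<rho> \<xi> (\<chi> i. T$i$j)) (axis j 1) + tensor (\<chi> i. T$i$j) (br \<xi> (axis j 1)))"

definition overshears :: "('m::finite) lie_bracket \<Rightarrow> (complex^'m \<Rightarrow> complex^'n::finite \<Rightarrow> complex^'n) \<Rightarrow> (complex^'m^'n) set" where
  "overshears br \<rho> = {tensor w \<xi> | w \<xi>. \<rho> \<xi> (\<rho> \<xi> w) = 0}"

text \<open>Complex scalar multiplication on W (x) g and complex subspaces of W (x) g.\<close>
definition tscale :: "complex \<Rightarrow> complex^'m::finite^'n::finite \<Rightarrow> complex^'m^'n" where
  "tscale c T = (\<chi> i j. c * T$i$j)"

definition tensor_subspace :: "(complex^'m::finite^'n::finite) set \<Rightarrow> bool" where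
  "tensor_subspace M \<longleftrightarrow> 0 \<in> M \<and> (\<forall>S\<in>M. \<forall>T\<in>M. S + T \<in> M) \<and> (\<forall>c. \<forall>T\<in>M. tscale c T \<in> M)"

text \<open>g-submodule of W (x) g generated by a set S.\<close>
definition generated_submodule :: "('m::finite) lie_bracket \<Rightarrow> (complex^'m \<Rightarrow> complex^'n::finite \<Rightarrow> complex^'n) \<Rightarrow> (complex^'m^'n) set \<Rightarrow> (complex^'m^'n) set" where
  "generated_submodule br \<rho> S =
     \<Inter>{M. tensor_subspace M \<and> S \<subseteq> M \<and> (\<forall>\<xi>. \<forall>T\<in>M. tensor_act br \<rho> \<xi> T \<in> M)}"

text \<open>A (x) B as the span of pure tensors a (x) b.\<close>
definition tensor_span :: "(complex^'n::finite) set \<Rightarrow> (complex^'m::finite) set \<Rightarrow> (complex^'m^'n) set" where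
  "tensor_span A B = \<Inter>{M. tensor_subspace M \<and> {tensor w H | w H. w \<in> A \<and> H \<in> B} \<subseteq> M}"

end

theory Submission
  imports Defs
begin

text \<open>The coroot \<open>H\<^sub>\<alpha>\<close> sits in an sl2-triple \<open>(E, F, H)\<close>. For a highest weight vector \<open>v\<close> of
  \<open>H\<close>-weight \<open>2m\<close>, the tensors \<open>v \<otimes> E\<close> and \<open>F v \<otimes> E\<close> are overshears, and acting on them with
  \<open>F\<close> and \<open>E\<close> yields \<open>F\<^sup>j v \<otimes> H\<close> for all \<open>j \<le> m\<close>, by descent from \<open>F\<^sup>m v \<otimes> H\<close>, which is
  an overshear because \<open>F\<^sup>m v\<close> has weight \<open>0\<close>. Every vector \<open>x\<close> of weight \<open>2k \<ge> 0\<close> differs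
  from such an \<open>F\<^sup>j v\<close> (up to a scalar) by a vector killed by a smaller power of \<open>E\<close>, so
  \<open>x \<otimes> H\<close> is in the submodule; negative \<open>k\<close> is handled by swapping \<open>E\<close> and \<open>F\<close>. Finally, if
  \<open>w\<close> has weight \<open>\<lambda>\<close> and \<open>H' \<in> h\<close>, then \<open>H' - (\<lambda>(H') / \<lambda>(H)) H\<close> annihilates \<open>w\<close>, so
  \<open>w \<otimes> H'\<close> is an overshear plus a multiple of \<open>w \<otimes> H\<close>.\<close>

section \<open>Eigenvectors of linear maps\<close>

lemma eigenvectors_independent:
  fixes f :: "'a::field^'n::finite \<Rightarrow> 'a^'n"
  assumes lin: "Vector_Spaces.linear (*s) (*s) f"
    and "finite S" "0 \<notin> S" "\<And>v. v \<in> S \<Longrightarrow> f v = c v *s v" "inj_on c S"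
  shows "vec.independent S"
  using assms(2-)
proof (induction S rule: finite_induct)
  case empty
  show ?case by (simp add: vec.independent_empty)
next
  case (insert a S)
  have indS: "vec.independent S"
    using insert by simp
  have "a \<notin> vec.span S"
  proof
    assume "a \<in> vec.span S"
    then obtain t where a: "a = (\<Sum>v\<in>S. t v *s v)"
      using vec.span_finite[OF \<open>finite S\<close>] by auto
    have "f a = (\<Sum>v\<in>S. (c v * t v) *s v)"
      using insert.prems(2)
      by (simp add: a vec.linear_sum[OF lin] vec.linear_scale[OF lin] mult.commute)
    moreover have "c a *s a = (\<Sum>v\<in>S. (c a * t v) *s v)"
      by (simp add: a vec.scale_sum_right)
    ultimately have "(\<Sum>v\<in>S. ((c v - c a) * t v) *s v) = f a - c a *s a"
      by (simp add: left_diff_distrib vec.scale_left_diff_distrib sum_subtractf)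
    also have "\<dots> = 0"
      using insert.prems(2) by simp
    finally have "\<forall>v\<in>S. (c v - c a) * t v = 0"
      using indS unfolding vec.independent_explicit
      by (blast dest: spec[where x = "\<lambda>v. (c v - c a) * t v"])
    moreover have "\<forall>v\<in>S. c v \<noteq> c a"
      using insert.prems(3) insert.hyps(2) by (metis insertCI inj_on_contraD)
    ultimately have "a = 0"
      unfolding a by simp
    then show False
      using insert.prems(1) by simp
  qed
  then show ?case
    using indS by (rule vec.independent_insertI)
qed

lemma finite_eigenvalues:
  fixes f :: "'a::field^'n::finite \<Rightarrow> 'a^'n"
  assumes lin: "Vector_Spaces.linear (*s) (*s) f"
  shows "finite {c. \<exists>v. v \<noteq> 0 \<and> f v = c *s v}"
proof -
  have "card G \<le> CARD('n)" if G: "G \<subseteq> {c. \<exists>v. v \<noteq> 0 \<and> f v = c *s v}" "finite G" for G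
  proof -
    obtain v where v: "\<And>c. c \<in> G \<Longrightarrow> v c \<noteq> 0 \<and> f (v c) = c *s v c"
      using G(1) by (simp add: subset_eq) metis
    have inj: "inj_on v G"
    proof (rule inj_onI)
      fix c d assume "c \<in> G" "d \<in> G" "v c = v d"
      then have "(c - d) *s v c = 0"
        using v by (metis vec.scale_left_diff_distrib right_minus_eq)
      then show "c = d"
        using v \<open>c \<in> G\<close> by simp
    qed
    have "vec.independent (v ` G)"
    proof (rule eigenvectors_independent[OF lin, where c = "the_inv_into G v"])
      show "inj_on (the_inv_into G v) (v ` G)"
        using inj by (rule inj_on_the_inv_into)
    qed (use G(2) v inj in \<open>auto simp: the_inv_into_f_f\<close>)
    then have "card (v ` G) \<le> vec.dim (UNIV :: ('a^'n) set)"
      by (intro vec.independent_card_le_dim) auto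
    then show ?thesis
      using card_image[OF inj] by (simp add: vec_dim_card card_cart_basis)
  qed
  then show ?thesis
    using finite_if_finite_subsets_card_bdd by blast
qed

lemma linear_funpow:
  assumes "Vector_Spaces.linear (*s) (*s) (f :: 'a::field^'n::finite \<Rightarrow> 'a^'n)"
  shows "Vector_Spaces.linear (*s) (*s) (f ^^ d)"
proof (induction d)
  case 0
  show ?case
    using vec.linear_id by (simp add: id_def)
next
  case (Suc d)
  show ?case
    using Vector_Spaces.linear_compose[OF Suc assms] by (simp add: o_def)
qed

lemma eigenvalue_shift_funpow:
  fixes f g :: "'a::field^'n::finite \<Rightarrow> 'a^'n"
  assumes lin: "Vector_Spaces.linear (*s) (*s) f"
    and comm: "\<And>y. g (f y) = f (g y) + a *s f y"
    and eig: "g x = \<mu> *s x"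
  shows "g ((f ^^ j) x) = (\<mu> + of_nat j * a) *s (f ^^ j) x"
proof (induction j)
  case 0
  show ?case
    using eig by simp
next
  case (Suc j)
  have "g ((f ^^ Suc j) x) = f ((\<mu> + of_nat j * a) *s (f ^^ j) x) + a *s f ((f ^^ j) x)"
    using comm Suc by simp
  also have "\<dots> = ((\<mu> + of_nat j * a) + a) *s f ((f ^^ j) x)"
    by (simp only: vec.linear_add[OF lin] vec.linear_scale[OF lin] vec.scale_left_distrib)
  also have "\<dots> = (\<mu> + of_nat (Suc j) * a) *s (f ^^ Suc j) x"
    by (simp add: algebra_simps)
  finally show ?case .
qed

section \<open>Pure tensors and the generated submodule\<close>

lemma tensor_component [simp]: "tensor x y $ i $ j = x $ i * y $ j"
  by (simp add: tensor_def)

lemma tscale_component [simp]: "tscale c T $ i $ j = c * T $ i $ j"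
  by (simp add: tscale_def)

lemma tensor_zero_left [simp]: "tensor 0 \<eta> = 0"
  by (simp add: vec_eq_iff)

lemma tensor_add_left: "tensor (x + y) \<eta> = tensor x \<eta> + tensor y \<eta>"
  by (simp add: vec_eq_iff algebra_simps)

lemma tensor_scale_left: "tensor (c *s x) \<eta> = tscale c (tensor x \<eta>)"
  by (simp add: vec_eq_iff algebra_simps)

lemma tscale_add: "tscale c (S + T) = tscale c S + tscale c T"
  by (simp add: vec_eq_iff algebra_simps)

lemma tscale_sum: "tscale c (\<Sum>j\<in>A. f j) = (\<Sum>j\<in>A. tscale c (f j))"
  by (simp add: vec_eq_iff sum_distrib_left)

lemma tensor_act_add:
  assumes "Vector_Spaces.linear (*s) (*s) (\<rho> \<xi>)"
  shows "tensor_act br \<rho> \<xi> (S + T) = tensor_act br \<rho> \<xi> S + tensor_act br \<rho> \<xi> T"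
proof -
  have col: "(\<chi> i. (S + T) $ i $ j) = (\<chi> i. S $ i $ j) + (\<chi> i. T $ i $ j)" for j
    by (simp add: vec_eq_iff)
  show ?thesis
    unfolding tensor_act_def col vec.linear_add[OF assms] tensor_add_left
    by (simp add: sum.distrib algebra_simps)
qed

lemma tensor_act_tscale:
  assumes "Vector_Spaces.linear (*s) (*s) (\<rho> \<xi>)"
  shows "tensor_act br \<rho> \<xi> (tscale c T) = tscale c (tensor_act br \<rho> \<xi> T)"
proof -
  have col: "(\<chi> i. tscale c T $ i $ j) = c *s (\<chi> i. T $ i $ j)" for j
    by (simp add: vec_eq_iff)
  show ?thesis
    unfolding tensor_act_def col vec.linear_scale[OF assms] tensor_scale_left tscale_sum tscale_add
    by simp
qed

lemma sum_axis_component: "(\<Sum>j\<in>UNIV. f j * axis j (1::'a::semiring_1) $ b) = f b"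
  by (simp add: axis_def if_distrib cong: if_cong)

lemma tensor_act_tensor:
  assumes lin_rho: "Vector_Spaces.linear (*s) (*s) (\<rho> \<xi>)"
    and lin_br: "Vector_Spaces.linear (*s) (*s) (br \<xi>)"
  shows "tensor_act br \<rho> \<xi> (tensor x \<eta>) = tensor (\<rho> \<xi> x) \<eta> + tensor x (br \<xi> \<eta>)"
proof -
  have col: "(\<chi> i. tensor x \<eta> $ i $ j) = \<eta> $ j *s x" for j
    by (simp add: vec_eq_iff mult.commute)
  have "tensor_act br \<rho> \<xi> (tensor x \<eta>) $ a $ b
      = (\<Sum>j\<in>UNIV. (\<rho> \<xi> x $ a * \<eta> $ j) * axis j 1 $ b)
        + x $ a * (\<Sum>j\<in>UNIV. \<eta> $ j * br \<xi> (axis j 1) $ b)" for a b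
    unfolding tensor_act_def col
    unfolding sum_component vector_add_component tensor_component
      vec.linear_scale[OF lin_rho] vector_smult_component sum_distrib_left sum.distrib
    by (simp add: mult_ac)
  also have "\<dots> a b = \<rho> \<xi> x $ a * \<eta> $ b + x $ a * br \<xi> \<eta> $ b" for a b
    using linear_componentwise[OF lin_br, of \<eta> b] by (simp add: sum_axis_component)
  finally show ?thesis
    by (simp add: vec_eq_iff)
qed

lemma generated_submodule_add:
  "S \<in> generated_submodule br \<rho> X \<Longrightarrow> T \<in> generated_submodule br \<rho> X
    \<Longrightarrow> S + T \<in> generated_submodule br \<rho> X"
  unfolding generated_submodule_def tensor_subspace_def by blast

lemma generated_submodule_tscale:
  "T \<in> generated_submodule br \<rho> X \<Longrightarrow> tscale c T \<in> generated_submodule br \<rho> X"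
  unfolding generated_submodule_def tensor_subspace_def by blast

lemma generated_submodule_tscale_cancel:
  assumes "tscale c T \<in> generated_submodule br \<rho> X" "c \<noteq> 0"
  shows "T \<in> generated_submodule br \<rho> X"
proof -
  have "T = tscale (1 / c) (tscale c T)"
    using assms(2) by (simp add: vec_eq_iff)
  then show ?thesis
    using generated_submodule_tscale[OF assms(1)] by metis
qed

lemma generated_submodule_diff:
  assumes "S \<in> generated_submodule br \<rho> X" "T \<in> generated_submodule br \<rho> X"
  shows "S - T \<in> generated_submodule br \<rho> X"
proof -
  have "S - T = S + tscale (-1) T"
    by (simp add: vec_eq_iff)
  then show ?thesis
    using assms generated_submodule_add generated_submodule_tscale by metis
qed

lemma generated_submodule_tensor_act:
  "T \<in> generated_submodule br \<rho> X \<Longrightarrow> tensor_act br \<rho> \<xi> T \<in> generated_submodule br \<rho> X"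
  unfolding generated_submodule_def by blast

lemma zero_in_generated_submodule: "0 \<in> generated_submodule br \<rho> X"
  unfolding generated_submodule_def tensor_subspace_def by blast

lemma tensor_subspace_generated_submodule: "tensor_subspace (generated_submodule br \<rho> X)"
  unfolding tensor_subspace_def
  by (simp add: zero_in_generated_submodule generated_submodule_add generated_submodule_tscale)

lemma overshear_in_generated_submodule:
  "\<rho> \<xi> (\<rho> \<xi> w) = 0 \<Longrightarrow> tensor w \<xi> \<in> generated_submodule br \<rho> (overshears br \<rho>)"
  unfolding generated_submodule_def overshears_def by blast

lemma tensor_span_subset:
  assumes "tensor_subspace M" "\<And>a b. a \<in> A \<Longrightarrow> b \<in> B \<Longrightarrow> tensor a b \<in> M"
  shows "tensor_span A B \<subseteq> M"
  unfolding tensor_span_def using assms by blast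

section \<open>sl2-triples acting on \<open>W \<otimes> g\<close>\<close>

lemma lie_bracket_antisym:
  assumes "lie_algebra br"
  shows "br y x = - br x y"
proof -
  have add_left: "br (a + b) c = br a c + br b c" for a b c
    using assms vec.linear_add[of "\<lambda>x. br x c"] by (simp add: lie_algebra_def)
  have add_right: "br a (b + c) = br a b + br a c" for a b c
    using assms vec.linear_add[of "br a"] by (simp add: lie_algebra_def)
  have alt: "br a a = 0" for a
    using assms by (simp add: lie_algebra_def)
  have "0 = br (x + y) (x + y)"
    by (simp only: alt)
  also have "\<dots> = br x x + br y x + (br x y + br y y)"
    by (simp only: add_left add_right)
  finally show ?thesis
    by (simp add: alt eq_neg_iff_add_eq_0)
qed

locale sl2_triple =
  fixes br :: "('m::finite) lie_bracket"
    and \<rho> :: "complex^'m \<Rightarrow> complex^'n::finite \<Rightarrow> complex^'n"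
    and E F H :: "complex^'m"
  assumes lie: "lie_algebra br"
    and rep: "representation br \<rho>"
    and bracket_H_E: "br H E = 2 *s E"
    and bracket_H_F: "br H F = (-2) *s F"
    and bracket_E_F: "br E F = H"
begin

abbreviation M :: "(complex^'m^'n) set"
  where "M \<equiv> generated_submodule br \<rho> (overshears br \<rho>)"

lemma bracket_F_E: "br F E = - H"
  using lie_bracket_antisym[OF lie, of E F] bracket_E_F by simp

lemma bracket_E_H: "br E H = (-2) *s E"
  using lie_bracket_antisym[OF lie, of H E] bracket_H_E by (simp add: vec_eq_iff)

lemma bracket_F_H: "br F H = 2 *s F"
  using lie_bracket_antisym[OF lie, of H F] bracket_H_F by (simp add: vec_eq_iff)

lemma bracket_F_F: "br F F = 0"
  using lie by (simp add: lie_algebra_def)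

lemma rho_linear: "Vector_Spaces.linear (*s) (*s) (\<rho> \<xi>)"
  using rep by (simp add: representation_def)

lemma rho_scale: "\<rho> \<xi> (c *s x) = c *s \<rho> \<xi> x"
  by (rule vec.linear_scale[OF rho_linear])

lemma rho_zero: "\<rho> \<xi> 0 = 0"
  by (rule vec.linear_0[OF rho_linear])

lemma rho_scale_left: "\<rho> (c *s \<xi>) x = c *s \<rho> \<xi> x"
  using rep vec.linear_scale[of "\<lambda>\<xi>. \<rho> \<xi> x"] by (simp add: representation_def)

lemma rho_bracket: "\<rho> (br \<xi> \<eta>) x = \<rho> \<xi> (\<rho> \<eta> x) - \<rho> \<eta> (\<rho> \<xi> x)"
  using rep by (simp add: representation_def)

lemma act_tensor: "tensor_act br \<rho> \<xi> (tensor x \<eta>) = tensor (\<rho> \<xi> x) \<eta> + tensor x (br \<xi> \<eta>)"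
  using lie by (simp add: tensor_act_tensor rho_linear lie_algebra_def)

lemma act_add: "tensor_act br \<rho> \<xi> (S + T) = tensor_act br \<rho> \<xi> S + tensor_act br \<rho> \<xi> T"
  by (rule tensor_act_add[OF rho_linear])

lemma act_tscale: "tensor_act br \<rho> \<xi> (tscale c T) = tscale c (tensor_act br \<rho> \<xi> T)"
  by (rule tensor_act_tscale[OF rho_linear])

lemma act_diff: "tensor_act br \<rho> \<xi> (S - T) = tensor_act br \<rho> \<xi> S - tensor_act br \<rho> \<xi> T"
proof -
  have "\<And>S T. S - T = S + tscale (-1) T"
    by (simp add: vec_eq_iff)
  then show ?thesis
    by (metis act_add act_tscale)
qed

lemma rho_H_rho_E: "\<rho> H (\<rho> E x) = \<rho> E (\<rho> H x) + 2 *s \<rho> E x"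
  using rho_bracket[of H E x] by (simp add: bracket_H_E rho_scale_left)

lemma rho_H_rho_F: "\<rho> H (\<rho> F x) = \<rho> F (\<rho> H x) + (-2) *s \<rho> F x"
  using rho_bracket[of H F x] unfolding bracket_H_F rho_scale_left
  by (metis add.commute diff_add_cancel)

lemma rho_E_rho_F: "\<rho> E (\<rho> F x) = \<rho> F (\<rho> E x) + \<rho> H x"
  using rho_bracket[of E F x] by (simp add: bracket_E_F)

lemma weight_rho_E_pow:
  "\<rho> H x = \<mu> *s x \<Longrightarrow> \<rho> H ((\<rho> E ^^ j) x) = (\<mu> + 2 * of_nat j) *s (\<rho> E ^^ j) x"
  using eigenvalue_shift_funpow[where f = "\<rho> E" and g = "\<rho> H" and a = 2, OF rho_linear rho_H_rho_E]
  by (simp add: mult.commute)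

lemma weight_rho_F_pow:
  "\<rho> H x = \<mu> *s x \<Longrightarrow> \<rho> H ((\<rho> F ^^ j) x) = (\<mu> - 2 * of_nat j) *s (\<rho> F ^^ j) x"
  using eigenvalue_shift_funpow[where f = "\<rho> F" and g = "\<rho> H" and a = "-2", OF rho_linear rho_H_rho_F]
  by (simp add: mult.commute)

lemma rho_E_nilpotent:
  assumes "\<rho> H x = \<mu> *s x"
  shows "\<exists>d. (\<rho> E ^^ d) x = 0"
proof (rule ccontr)
  assume "\<nexists>d. (\<rho> E ^^ d) x = 0"
  then have "range (\<lambda>j. \<mu> + 2 * of_nat j) \<subseteq> {c. \<exists>v. v \<noteq> 0 \<and> \<rho> H v = c *s v}"
    using weight_rho_E_pow[OF assms] by blast
  moreover have "inj (\<lambda>j::nat. \<mu> + 2 * of_nat j)"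
    by (rule injI) simp
  ultimately show False
    using finite_eigenvalues[OF rho_linear] range_inj_infinite finite_subset by blast
qed

lemma rho_E_rho_F_pow:
  assumes "\<rho> E v = 0" "\<rho> H v = n *s v"
  shows "\<rho> E (\<rho> F ((\<rho> F ^^ j) v)) = (of_nat (Suc j) * (n - of_nat j)) *s (\<rho> F ^^ j) v"
proof (induction j)
  case 0
  show ?case
    using assms by (simp add: rho_E_rho_F rho_zero)
next
  case (Suc j)
  have "\<rho> E (\<rho> F ((\<rho> F ^^ Suc j) v))
      = \<rho> F (\<rho> E ((\<rho> F ^^ Suc j) v)) + \<rho> H ((\<rho> F ^^ Suc j) v)"
    by (rule rho_E_rho_F)
  also have "\<dots> = \<rho> F ((of_nat (Suc j) * (n - of_nat j)) *s (\<rho> F ^^ j) v)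
      + (n - 2 * of_nat (Suc j)) *s (\<rho> F ^^ Suc j) v"
    using Suc.IH weight_rho_F_pow[OF assms(2), of "Suc j"] by simp
  also have "\<dots> = (of_nat (Suc (Suc j)) * (n - of_nat (Suc j))) *s (\<rho> F ^^ Suc j) v"
    by (simp only: rho_scale) (simp add: vec_eq_iff algebra_simps)
  finally show ?case .
qed

lemma rho_E_pow_rho_F_pow:
  assumes "\<rho> E v = 0" "\<rho> H v = n *s v"
  shows "(\<rho> E ^^ d) ((\<rho> F ^^ d) v) = (\<Prod>j<d. of_nat (Suc j) * (n - of_nat j)) *s v"
proof (induction d)
  case 0
  show ?case by simp
next
  case (Suc d)
  have "(\<rho> E ^^ Suc d) ((\<rho> F ^^ Suc d) v) = (\<rho> E ^^ d) (\<rho> E (\<rho> F ((\<rho> F ^^ d) v)))"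
    by (simp only: funpow_Suc_right[where f = "\<rho> E"] funpow.simps(2)[where f = "\<rho> F"] o_apply)
  also have "\<dots> = (of_nat (Suc d) * (n - of_nat d)) *s (\<rho> E ^^ d) ((\<rho> F ^^ d) v)"
    by (simp only: rho_E_rho_F_pow[OF assms] vec.linear_scale[OF linear_funpow[OF rho_linear]])
  finally show ?case
    by (simp add: Suc mult.commute)
qed

lemma rho_E_pow_rho_F_pow_nonzero:
  assumes "\<rho> E v = 0" "\<rho> H v = of_nat n *s v" "d \<le> n"
  obtains P where "P \<noteq> 0" "(\<rho> E ^^ d) ((\<rho> F ^^ d) v) = P *s v"
proof
  have "(of_nat n :: complex) \<noteq> of_nat j" if "j < d" for j
    using that assms(3) by (simp only: of_nat_eq_iff)
  then show "(\<Prod>j<d. of_nat (Suc j) * (of_nat n - of_nat j)) \<noteq> (0 :: complex)"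
    by (simp del: of_nat_Suc)
qed (rule rho_E_pow_rho_F_pow[OF assms(1,2)])

lemma tensor_highest_weight_H:
  assumes "\<rho> E v = 0" "\<rho> H v = n *s v"
  shows "tensor v H \<in> M"
proof -
  have "tensor v E \<in> M"
    by (rule overshear_in_generated_submodule) (simp add: assms rho_zero)
  moreover have "tensor (\<rho> F v) E \<in> M"
    by (rule overshear_in_generated_submodule) (simp add: rho_E_rho_F assms rho_scale rho_zero)
  moreover have "tensor v H = tensor (\<rho> F v) E - tensor_act br \<rho> F (tensor v E)"
    by (simp add: act_tensor bracket_F_E vec_eq_iff)
  ultimately show ?thesis
    by (simp add: generated_submodule_diff generated_submodule_tensor_act)
qed

lemma tensor_lowering_H:
  assumes "\<rho> E v = 0" "\<rho> H v = n *s v"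
  shows "tensor ((\<rho> F ^^ Suc j) v) H + tscale (2 * of_nat (Suc j)) (tensor ((\<rho> F ^^ j) v) F) \<in> M"
proof (induction j)
  case 0
  have "tensor ((\<rho> F ^^ Suc 0) v) H + tscale (2 * of_nat (Suc 0)) (tensor ((\<rho> F ^^ 0) v) F)
      = tensor_act br \<rho> F (tensor v H)"
    by (simp add: act_tensor bracket_F_H vec_eq_iff)
  then show ?case
    using generated_submodule_tensor_act[OF tensor_highest_weight_H[OF assms]] by simp
next
  case (Suc j)
  have "tensor ((\<rho> F ^^ Suc (Suc j)) v) H
        + tscale (2 * of_nat (Suc (Suc j))) (tensor ((\<rho> F ^^ Suc j) v) F)
      = tensor_act br \<rho> F (tensor ((\<rho> F ^^ Suc j) v) H
        + tscale (2 * of_nat (Suc j)) (tensor ((\<rho> F ^^ j) v) F))"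
    by (simp add: act_add act_tscale act_tensor bracket_F_H bracket_F_F vec_eq_iff algebra_simps)
  then show ?case
    using generated_submodule_tensor_act[OF Suc] by simp
qed

lemma tensor_lowering_E:
  assumes "\<rho> E v = 0" "\<rho> H v = n *s v"
  shows "tensor ((\<rho> F ^^ Suc j) v) E - tscale (of_nat (Suc j) / 2) (tensor ((\<rho> F ^^ j) v) H) \<in> M"
proof (induction j)
  case 0
  have "tensor (\<rho> F v) E \<in> M"
    by (rule overshear_in_generated_submodule) (simp add: rho_E_rho_F assms rho_scale rho_zero)
  then show ?case
    using generated_submodule_diff[OF _ generated_submodule_tscale[OF tensor_highest_weight_H[OF assms]]]
    by simp
next
  case (Suc j)
  have "tensor ((\<rho> F ^^ Suc (Suc j)) v) E
        - tscale (of_nat (Suc (Suc j)) / 2) (tensor ((\<rho> F ^^ Suc j) v) H)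
      = tensor_act br \<rho> F (tensor ((\<rho> F ^^ Suc j) v) E
          - tscale (of_nat (Suc j) / 2) (tensor ((\<rho> F ^^ j) v) H))
        + tscale (1 / 2) (tensor ((\<rho> F ^^ Suc j) v) H
          + tscale (2 * of_nat (Suc j)) (tensor ((\<rho> F ^^ j) v) F))"
    by (simp add: act_diff act_tscale act_tensor bracket_F_H bracket_F_E vec_eq_iff field_simps)
  then show ?case
    using generated_submodule_add[OF generated_submodule_tensor_act[OF Suc]
        generated_submodule_tscale[OF tensor_lowering_H[OF assms]]]
    by simp
qed

lemma tensor_string_H_step:
  assumes "\<rho> E v = 0" "\<rho> H v = n *s v" "n \<noteq> of_nat (Suc j)"
    and "tensor ((\<rho> F ^^ Suc j) v) H \<in> M"
  shows "tensor ((\<rho> F ^^ j) v) H \<in> M"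
proof -
  define c where "c = of_nat (Suc j) * (n - of_nat j) - of_nat (Suc j)"
  have "c = of_nat (Suc j) * (n - of_nat (Suc j))"
    by (simp add: c_def algebra_simps)
  then have "c \<noteq> 0"
    using assms(3) by (simp del: of_nat_Suc)
  have "tscale c (tensor ((\<rho> F ^^ j) v) H)
      = tensor_act br \<rho> E (tensor ((\<rho> F ^^ Suc j) v) H)
        + tscale 2 (tensor ((\<rho> F ^^ Suc j) v) E
          - tscale (of_nat (Suc j) / 2) (tensor ((\<rho> F ^^ j) v) H))"
    by (simp add: act_tensor bracket_E_H rho_E_rho_F_pow[OF assms(1,2)] c_def vec_eq_iff
        algebra_simps)
  then have "tscale c (tensor ((\<rho> F ^^ j) v) H) \<in> M"
    using generated_submodule_add[OF generated_submodule_tensor_act[OF assms(4)]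
        generated_submodule_tscale[OF tensor_lowering_E[OF assms(1,2)]]]
    by simp
  then show ?thesis
    using \<open>c \<noteq> 0\<close> by (rule generated_submodule_tscale_cancel)
qed

lemma tensor_string_H:
  assumes "\<rho> E v = 0" "\<rho> H v = of_nat (2 * m) *s v" "j \<le> m"
  shows "tensor ((\<rho> F ^^ j) v) H \<in> M"
  using assms(3)
proof (induction rule: inc_induct)
  case base
  show ?case
    by (rule overshear_in_generated_submodule) (simp add: weight_rho_F_pow[OF assms(2)] rho_zero)
next
  case (step i)
  then have "of_nat (2 * m) \<noteq> (of_nat (Suc i) :: complex)"
    by (simp only: of_nat_eq_iff)
  with step show ?case
    using tensor_string_H_step[OF assms(1,2)] by blast
qed

lemma tensor_even_weight_H:
  assumes "\<rho> H x = of_nat (2 * k) *s x"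
  shows "tensor x H \<in> M"
proof -
  obtain d where "(\<rho> E ^^ d) x = 0"
    using rho_E_nilpotent[OF assms] by blast
  then show ?thesis
    using assms
  proof (induction d arbitrary: x)
    case 0
    then show ?case
      by (simp add: zero_in_generated_submodule)
  next
    case (Suc d)
    define v where "v = (\<rho> E ^^ d) x"
    have Ev: "\<rho> E v = 0"
      using Suc.prems(1) by (simp add: v_def)
    have Hv: "\<rho> H v = of_nat (2 * (k + d)) *s v"
      unfolding v_def weight_rho_E_pow[OF Suc.prems(2)] by (simp add: algebra_simps)
    obtain P where "P \<noteq> 0" and E_pow_F_pow: "(\<rho> E ^^ d) ((\<rho> F ^^ d) v) = P *s v"
      using rho_E_pow_rho_F_pow_nonzero[OF Ev Hv, where d = d] by auto
    \<comment> \<open>\<open>y = F\<^sup>d E\<^sup>d x\<close> has the weight of \<open>x\<close> and \<open>E\<^sup>d y = P E\<^sup>d x\<close>, so \<open>E\<^sup>d\<close> kills \<open>x - y / P\<close>.\<close>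
    define y where "y = (\<rho> F ^^ d) v"
    have Hy: "\<rho> H y = of_nat (2 * k) *s y"
      unfolding y_def weight_rho_F_pow[OF Hv] by (simp add: algebra_simps)
    have E_pow_y: "(\<rho> E ^^ d) y = P *s (\<rho> E ^^ d) x"
      unfolding y_def E_pow_F_pow by (simp add: v_def)
    have "tensor (x - (1 / P) *s y) H \<in> M"
    proof (rule Suc.IH)
      have lin: "Vector_Spaces.linear (*s) (*s) (\<rho> E ^^ d)"
        by (rule linear_funpow[OF rho_linear])
      show "(\<rho> E ^^ d) (x - (1 / P) *s y) = 0"
        using \<open>P \<noteq> 0\<close> by (simp add: vec.linear_diff[OF lin] vec.linear_scale[OF lin] E_pow_y)
      show "\<rho> H (x - (1 / P) *s y) = of_nat (2 * k) *s (x - (1 / P) *s y)"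
        using Suc.prems(2) Hy
        by (simp add: vec.linear_diff[OF rho_linear] rho_scale vec_eq_iff algebra_simps)
    qed
    moreover have "tensor y H \<in> M"
      unfolding y_def by (rule tensor_string_H[OF Ev Hv]) simp
    moreover have "tensor x H = tensor (x - (1 / P) *s y) H + tscale (1 / P) (tensor y H)"
      by (simp add: vec_eq_iff algebra_simps)
    ultimately show ?case
      by (simp add: generated_submodule_add generated_submodule_tscale)
  qed
qed

lemma sl2_triple_swap: "sl2_triple br \<rho> F E (- H)"
proof unfold_locales
  have "br (- H) \<xi> = - br H \<xi>" for \<xi>
    using lie vec.linear_neg[of "\<lambda>x. br x \<xi>"] by (simp add: lie_algebra_def)
  then show "br (- H) F = 2 *s F" "br (- H) E = (-2) *s E"
    using bracket_H_F bracket_H_E by (simp_all add: vec_eq_iff)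
qed (simp_all add: lie rep bracket_F_E)

lemma tensor_even_int_weight_H:
  assumes "\<rho> H w = of_int (2 * k) *s w"
  shows "tensor w H \<in> M"
proof (cases "k \<ge> 0")
  case True
  then have "\<rho> H w = of_nat (2 * nat k) *s w"
    using assms by simp
  then show ?thesis
    by (rule tensor_even_weight_H)
next
  case False
  have "\<rho> (- H) w = - \<rho> H w"
    using rep vec.linear_neg[of "\<lambda>\<xi>. \<rho> \<xi> w"] by (simp add: representation_def)
  then have "\<rho> (- H) w = of_nat (2 * nat (- k)) *s w"
    using assms False by (simp add: vec_eq_iff)
  then have "tensor w (- H) \<in> M"
    by (rule sl2_triple.tensor_even_weight_H[OF sl2_triple_swap])
  moreover have "tensor w H = tscale (-1) (tensor w (- H))"
    by (simp add: vec_eq_iff)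
  ultimately show ?thesis
    by (simp add: generated_submodule_tscale)
qed

end

lemma tensor_eigenvector_in_generated_submodule:
  assumes rep: "representation br \<rho>"
    and "\<rho> H\<^sub>0 w = a *s w" "\<rho> H w = b *s w" "a \<noteq> 0"
    and "tensor w H\<^sub>0 \<in> generated_submodule br \<rho> (overshears br \<rho>)"
  shows "tensor w H \<in> generated_submodule br \<rho> (overshears br \<rho>)"
proof -
  define c where "c = b / a"
  have lin: "Vector_Spaces.linear (*s) (*s) (\<lambda>\<xi>. \<rho> \<xi> w)" "Vector_Spaces.linear (*s) (*s) (\<rho> \<xi>)"
    for \<xi> using rep by (simp_all add: representation_def)
  have "\<rho> (H - c *s H\<^sub>0) w = b *s w - c *s (a *s w)"
    using assms(2,3) by (simp add: vec.linear_diff[OF lin(1)] vec.linear_scale[OF lin(1)])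
  also have "\<dots> = 0"
    using \<open>a \<noteq> 0\<close> by (simp add: c_def vec_eq_iff)
  finally have "tensor w (H - c *s H\<^sub>0) \<in> generated_submodule br \<rho> (overshears br \<rho>)"
    by (intro overshear_in_generated_submodule) (simp add: vec.linear_0[OF lin(2)])
  moreover have "tensor w H = tensor w (H - c *s H\<^sub>0) + tscale c (tensor w H\<^sub>0)"
    by (simp add: vec_eq_iff algebra_simps)
  ultimately show ?thesis
    using assms(5) by (simp add: generated_submodule_add generated_submodule_tscale)
qed

theorem lemma3p9:
  fixes br :: "('m::finite) lie_bracket"
    and \<rho> :: "complex^'m \<Rightarrow> complex^'n::finite \<Rightarrow> complex^'n"
    and h :: "(complex^'m) set"
    and lam :: "complex^'m \<Rightarrow> complex"
  assumes "semisimple br"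
    and "representation br \<rho>"
    and "cartan_subalgebra br h"
    and "is_weight \<rho> h lam"
    and "\<exists>\<alpha> Ha. is_coroot br h \<alpha> Ha \<and> (\<exists>k::int. k \<noteq> 0 \<and> lam Ha = of_int (2 * k))"
  shows "tensor_span (weight_space \<rho> h lam) h \<subseteq> generated_submodule br \<rho> (overshears br \<rho>)"
proof -
  obtain \<alpha> Ha k where coroot: "is_coroot br h \<alpha> Ha" and "k \<noteq> 0" and lam_Ha: "lam Ha = of_int (2 * k)"
    using assms(5) by blast
  obtain E F where "br Ha E = 2 *s E" "br Ha F = (-2) *s F" "br E F = Ha"
    using coroot unfolding is_coroot_def by blast
  then interpret sl2_triple br \<rho> E F Ha
    using assms(1,2) by unfold_locales (simp_all add: semisimple_def)
  have "Ha \<in> h"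
    using coroot by (simp add: is_coroot_def)
  \<comment> \<open>Semisimplicity is only used through the Lie algebra axioms.\<close>
  have "tensor w H \<in> M" if w: "w \<in> weight_space \<rho> h lam" and "H \<in> h" for w H
  proof (rule tensor_eigenvector_in_generated_submodule[OF assms(2)])
    show "\<rho> Ha w = lam Ha *s w" "\<rho> H w = lam H *s w"
      using w \<open>Ha \<in> h\<close> \<open>H \<in> h\<close> by (simp_all add: weight_space_def)
    then show "tensor w Ha \<in> M"
      using lam_Ha by (intro tensor_even_int_weight_H[where k = k]) simp
    show "lam Ha \<noteq> 0"
      using lam_Ha \<open>k \<noteq> 0\<close> by simp
  qed
  then show ?thesis
    by (intro tensor_span_subset tensor_subspace_generated_submodule)
qed

end
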